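(* Let $a,\tilde a,\alpha\in\mathbb{R}$ be such that $a\sim\tilde a\,;\,\mathrm{rp}(\alpha)$. Then $$\left|\frac{a-\tilde a}{a}\right|\le |e^{\alpha}-1|.$$
   Context: For $a,\tilde a,\alpha\in\mathbb{R}$, the notation $a\sim\tilde a\,;\,\mathrm{rp}(\alpha)$ ("$\tilde a$ is an approximation to $a$ of relative precision $\alpha$") means: $\alpha\ge 0$, $a$ and $\tilde a$ are nonzero and have the same sign, and $|\ln(\tilde a/a)|\le\alpha$. *)

theory Defs
  imports Complex_Main
begin

text \<open>\<^term>\<open>rp_approx a a' \<alpha>\<close> renders the notation \<open>a \<sim> a' ; rp(\<alpha>)\<close>: the number \<open>a'\<close> is an
  approximation to \<open>a\<close> of relative precision \<open>\<alpha>\<close>.\<close>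

definition rp_approx :: "real \<Rightarrow> real \<Rightarrow> real \<Rightarrow> bool" where
  "rp_approx a a' \<alpha> \<longleftrightarrow>
     \<alpha> \<ge> 0 \<and> a \<noteq> 0 \<and> a' \<noteq> 0 \<and> sgn a = sgn a' \<and> \<bar>ln (a' / a)\<bar> \<le> \<alpha>"

end

theory Submission
  imports Defs
begin

text \<open>Since \<open>a\<close> and \<open>a'\<close> have the same sign, \<open>a' / a = exp t\<close> for \<open>t = ln (a' / a)\<close>, so the
  relative error is \<open>\<bar>1 - exp t\<bar>\<close>, and \<open>\<bar>t\<bar> \<le> \<alpha>\<close>. As the exponential is convex, it moves away
  from its value at \<open>0\<close> at least as fast to the right as to the left; hence the error is at most
  \<open>exp \<bar>t\<bar> - 1\<close>, which monotonicity bounds by \<open>exp \<alpha> - 1\<close>.\<close>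

lemma abs_exp_minus_one_le:
  fixes t :: real
  shows "\<bar>exp t - 1\<bar> \<le> exp \<bar>t\<bar> - 1"
proof (cases "t \<ge> 0")
  case True
  then show ?thesis by simp
next
  case False
  \<comment> \<open>The tangent \<open>1 + x\<close> of \<open>exp\<close> at \<open>0\<close>, taken at \<open>t\<close> and at \<open>- t\<close>, puts \<open>- t\<close> between the two sides.\<close>
  have "1 - exp t \<le> - t"
    using exp_ge_add_one_self[of t] by linarith
  also have "\<dots> \<le> exp (- t) - 1"
    using exp_ge_add_one_self[of "- t"] by linarith
  finally show ?thesis using False by simp
qed

theorem theorem3p2:
  fixes a a' \<alpha> :: real
  assumes "rp_approx a a' \<alpha>"
  shows "\<bar>(a - a') / a\<bar> \<le> \<bar>exp \<alpha> - 1\<bar>"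
proof -
  define t where "t = ln (a' / a)"
  from assms have a: "a \<noteq> 0" and a': "a' \<noteq> 0" and sgn: "sgn a = sgn a'" and t: "\<bar>t\<bar> \<le> \<alpha>"
    by (auto simp: rp_approx_def t_def)
  from a a' sgn have "a' / a > 0"
    by (auto simp: sgn_if zero_less_divide_iff split: if_splits)
  then have "exp t = a' / a"
    by (simp add: t_def)
  with a have "\<bar>(a - a') / a\<bar> = \<bar>exp t - 1\<bar>"
    by (simp add: diff_divide_distrib abs_minus_commute)
  also have "\<dots> \<le> exp \<bar>t\<bar> - 1"
    by (rule abs_exp_minus_one_le)
  also have "\<dots> \<le> exp \<alpha> - 1"
    using t by simp
  also have "\<dots> \<le> \<bar>exp \<alpha> - 1\<bar>"
    by simp
  finally show ?thesis .
qed

end
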